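(* Let $q>0$. For all initial states $(\rho^l,v^l),(\rho^r,v^r)\in\mathcal D$, let $\tilde v_1$ and $\tilde v_2$ denote the $v$-components of $\mathcal{RS}^q_1((\rho^l,v^l),(\rho^r,v^r))$ and $\mathcal{RS}^q_2((\rho^l,v^l),(\rho^r,v^r))$ respectively. Then $$\mathrm{Tot.Var.}(\tilde v_1)\ \ge\ \mathrm{Tot.Var.}(\tilde v_2),$$ where $\mathrm{Tot.Var.}$ is the total variation over $x\in\mathbb R$.
   Context: Pressure. $p\in C^2([0,+\infty);[0,+\infty))$ satisfies $p(0)=0$, $p'(\rho)>0$ for all $\rho>0$, and $\rho\mapsto\rho p(\rho)$ is strictly convex. System. $\mathcal D=\mathbb R^+\times\mathbb R^+$ with $\mathbb R^+=[0,+\infty)$; states are $(\rho,v)\in\mathcal D$. The Aw-Rascle system is $\partial_t\rho+\partial_x(\rho v)=0$, $\partial_t(\rho(v+p(\rho)))+\partial_x(\rho v(v+p(\rho)))=0$. Write $f_1(\rho,v)=\rho v$ and $\lambda_1(\rho,v)=v-\rho p'(\rho)$. Classical Riemann solver. For $(\rho^l,v^l),(\rho^r,v^r)\in\mathcal D$, $\mathcal{RS}((\rho^l,v^l),(\rho^r,v^r))$ is the function of $x\in\mathbb R$ (the unconstrained self-similar solution at time $t=1$ with left/right initial states separated at $x=0$) defined a.e. as follows, with $w^l=v^l+p(\rho^l)$. Let $I_2=\{\rho\ge0:\ v^l+p(\rho^l)-p(\rho)=v^r\}$; the intermediate state in cases (a) and (b) is $(\rho^m,v^m)$ with $\rho^m=\max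 I_2$, $v^m=v^r$. (a) If $v^r\le v^l$: it equals $(\rho^l,v^l)$ for $x<\sigma$, $(\rho^m,v^m)$ for $\sigma<x<v^r$, $(\rho^r,v^r)$ for $x>v^r$, where $\sigma=(\rho^mv^m-\rho^lv^l)/(\rho^m-\rho^l)$ if $\rho^m\ne\rho^l$; if $\rho^m=\rho^l$ it equals $(\rho^l,v^l)$ for $x<v^r$ and $(\rho^r,v^r)$ for $x>v^r$. (b) If $v^l<v^r\le w^l$: it equals $(\rho^l,v^l)$ for $x<\lambda_1(\rho^l,v^l)$; for $\lambda_1(\rho^l,v^l)\le x\le\lambda_1(\rho^m,v^m)$ it is the unique state $(\rho,\,w^l-p(\rho))$ with $\rho^m\le\rho\le\rho^l$ and $\lambda_1(\rho,w^l-p(\rho))=x$; $(\rho^m,v^m)$ for $\lambda_1(\rho^m,v^m)<x<v^r$; $(\rho^r,v^r)$ for $x>v^r$. (c) If $v^r>w^l$ (vacuum): it equals $(\rho^l,v^l)$ for $x<\lambda_1(\rho^l,v^l)$; for $\lambda_1(\rho^l,v^l)\le x\le w^l$ it is the state $(\rho,w^l-p(\rho))$ with $0\le\rho\le\rho^l$ and $\lambda_1=x$; $(0,x)$ for $w^l<x<v^r$; $(\rho^r,v^r)$ for $x>v^r$. $f_1(\mathcal{RS}(\cdot,\cdot)(0))$ denotes the common value of $f_1$ at the one-sided traces at $x=0$. Constrained solvers. Given $q>0$, let $I_1=\{\rho\ge0:\ \rho\,(v^l+p(\rho^l)-p(\rho))=q\}$ and, when $I_1\neq\emptyset$, $\hat\rho=\max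 I_1$, $\hat v=q/\hat\rho$, $\check\rho_1=\min I_1$, $\check v_1=q/\check\rho_1$. Let also $\check v_2=v^r$, $\check\rho_2=q/v^r$ (when $v^r>0$, which always holds when these are used below). For $i\in\{1,2\}$: if $f_1(\mathcal{RS}((\rho^l,v^l),(\rho^r,v^r))(0))\le q$, then $\mathcal{RS}^q_i((\rho^l,v^l),(\rho^r,v^r))=\mathcal{RS}((\rho^l,v^l),(\rho^r,v^r))$; otherwise $\mathcal{RS}^q_i((\rho^l,v^l),(\rho^r,v^r))(x)$ equals $\mathcal{RS}((\rho^l,v^l),(\hat\rho,\hat v))(x)$ for $x<0$ and $\mathcal{RS}((\check\rho_i,\check v_i),(\rho^r,v^r))(x)$ for $x>0$. Functions of $x$ are considered up to a.e. equality; the total variation is the essential one (that of a good representative). *)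

theory Defs
  imports "HOL-Analysis.Analysis"
begin

text \<open>
  A pressure law is a total function on the reals of which only the restriction to
  \<open>[0,\<infinity>)\<close> matters; the \<open>C\<^sup>2\<close> condition uses one-sided derivatives at \<open>0\<close>.
\<close>

definition pressure :: "(real \<Rightarrow> real) \<Rightarrow> bool" where
  "pressure p \<longleftrightarrow>
     (\<exists>dp ddp.
        (\<forall>\<rho>\<ge>0. (p has_real_derivative dp \<rho>) (at \<rho> within {0..}) \<and>
                (dp has_real_derivative ddp \<rho>) (at \<rho> within {0..})) \<and>
        continuous_on {0..} ddp \<and>
        (\<forall>\<rho>>0. dp \<rho> > 0)) \<and>
     (\<forall>\<rho>\<ge>0. p \<rho> \<ge> 0) \<and>
     p 0 = 0 \<and>
     (\<forall>x\<ge>0. \<forall>y\<ge>0. \<forall>t. x \<noteq> y \<longrightarrow> 0 < t \<longrightarrow> t < 1 \<longrightarrow>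
        ((1 - t) * x + t * y) * p ((1 - t) * x + t * y)
          < (1 - t) * (x * p x) + t * (y * p y))"

type_synonym state = "real \<times> real"

definition states :: "state set" where
  "states = {0..} \<times> {0..}"

definition f1 :: "state \<Rightarrow> real" where
  "f1 = (\<lambda>(\<rho>, v). \<rho> * v)"

text \<open>At \<open>\<rho> = 0\<close> the (two-sided) derivative is multiplied by \<open>0\<close>, so its value there is irrelevant.\<close>

definition lambda1 :: "(real \<Rightarrow> real) \<Rightarrow> state \<Rightarrow> real" where
  "lambda1 p = (\<lambda>(\<rho>, v). v - \<rho> * deriv p \<rho>)"

definition wvar :: "(real \<Rightarrow> real) \<Rightarrow> state \<Rightarrow> real" where
  "wvar p = (\<lambda>(\<rho>, v). v + p \<rho>)"

text \<open>
  The sets \<open>I2\<close> and \<open>I1\<close> below are finite, so that \<^const>\<open>Max\<close> and \<^const>\<open>Min\<close> are the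
  true maximum and minimum whenever the sets are nonempty: \<open>I2\<close> has at most one element because
  \<open>p\<close> is strictly increasing on \<open>[0,\<infinity>)\<close>, and \<open>I1\<close> at most two because
  \<open>\<rho> \<mapsto> \<rho> (w - p \<rho>)\<close> is strictly concave there.
\<close>

definition I2 :: "(real \<Rightarrow> real) \<Rightarrow> state \<Rightarrow> state \<Rightarrow> real set" where
  "I2 p l r = {\<rho>. \<rho> \<ge> 0 \<and> snd l + p (fst l) - p \<rho> = snd r}"

definition mid_state :: "(real \<Rightarrow> real) \<Rightarrow> state \<Rightarrow> state \<Rightarrow> state" where
  "mid_state p l r = (Max (I2 p l r), snd r)"

text \<open>The state of the 1-rarefaction fan from \<open>l\<close>, down to density \<open>\<rho>0\<close>, at position \<open>x\<close>.\<close>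

definition fan :: "(real \<Rightarrow> real) \<Rightarrow> state \<Rightarrow> real \<Rightarrow> real \<Rightarrow> state" where
  "fan p l \<rho>0 x =
     (THE s. \<exists>\<rho>. s = (\<rho>, wvar p l - p \<rho>) \<and> \<rho>0 \<le> \<rho> \<and> \<rho> \<le> fst l \<and> lambda1 p s = x)"

text \<open>
  The classical Riemann solver, as a representative of its a.e. class: the values at the
  finitely many jump points are an arbitrary choice, immaterial for the one-sided traces and
  for the essential total variation.
\<close>

definition RS :: "(real \<Rightarrow> real) \<Rightarrow> state \<Rightarrow> state \<Rightarrow> real \<Rightarrow> state" where
  "RS p l r x =
     (let m = mid_state p l r; w = wvar p l; vl = snd l; vr = snd r in
      if vr \<le> vl then
        (if fst m \<noteq> fst l then
           (let \<sigma> = (fst m * snd m - fst l * snd l) / (fst m - fst l) in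
            if x < \<sigma> then l else if x < vr then m else r)
         else if x < vr then l else r)
      else if vr \<le> w then
        (if x < lambda1 p l then l
         else if x \<le> lambda1 p m then fan p l (fst m) x
         else if x < vr then m
         else r)
      else
        (if x < lambda1 p l then l
         else if x \<le> w then fan p l 0 x
         else if x < vr then (0, x)
         else r))"

text \<open>The common value of \<open>f1\<close> at the one-sided traces of \<open>u\<close> at \<open>0\<close>.\<close>

definition f1_trace0 :: "(real \<Rightarrow> state) \<Rightarrow> real" where
  "f1_trace0 u =
     (THE y. \<exists>s t. (u \<longlongrightarrow> s) (at_left 0) \<and> (u \<longlongrightarrow> t) (at_right 0) \<and> f1 s = y \<and> f1 t = y)"

definition I1 :: "(real \<Rightarrow> real) \<Rightarrow> real \<Rightarrow> state \<Rightarrow> real set" where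
  "I1 p q l = {\<rho>. \<rho> \<ge> 0 \<and> \<rho> * (snd l + p (fst l) - p \<rho>) = q}"

definition hat_state :: "(real \<Rightarrow> real) \<Rightarrow> real \<Rightarrow> state \<Rightarrow> state" where
  "hat_state p q l = (let \<rho> = Max (I1 p q l) in (\<rho>, q / \<rho>))"

definition check_state1 :: "(real \<Rightarrow> real) \<Rightarrow> real \<Rightarrow> state \<Rightarrow> state" where
  "check_state1 p q l = (let \<rho> = Min (I1 p q l) in (\<rho>, q / \<rho>))"

definition check_state2 :: "real \<Rightarrow> state \<Rightarrow> state" where
  "check_state2 q r = (q / snd r, snd r)"

text \<open>The constrained solver whose right trace state at the constraint is \<open>c\<close>.\<close>

definition constrained_RS ::
  "(real \<Rightarrow> real) \<Rightarrow> real \<Rightarrow> state \<Rightarrow> state \<Rightarrow> state \<Rightarrow> real \<Rightarrow> state" where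
  "constrained_RS p q c l r =
     (if f1_trace0 (RS p l r) \<le> q then RS p l r
      else (\<lambda>x. if x < 0 then RS p l (hat_state p q l) x else RS p c r x))"

definition RSq1 :: "(real \<Rightarrow> real) \<Rightarrow> real \<Rightarrow> state \<Rightarrow> state \<Rightarrow> real \<Rightarrow> state" where
  "RSq1 p q l r = constrained_RS p q (check_state1 p q l) l r"

definition RSq2 :: "(real \<Rightarrow> real) \<Rightarrow> real \<Rightarrow> state \<Rightarrow> state \<Rightarrow> real \<Rightarrow> state" where
  "RSq2 p q l r = constrained_RS p q (check_state2 q r) l r"

definition pointwise_tot_var :: "(real \<Rightarrow> real) \<Rightarrow> ereal" where
  "pointwise_tot_var g =
     (SUP (n, t) \<in> {(n :: nat, t :: nat \<Rightarrow> real). mono t}.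
        ereal (\<Sum>i<n. \<bar>g (t (Suc i)) - g (t i)\<bar>))"

text \<open>Essential total variation: the least pointwise variation over the a.e. class.\<close>

definition tot_var :: "(real \<Rightarrow> real) \<Rightarrow> ereal" where
  "tot_var f = (INF g \<in> {g. AE x in lebesgue. g x = f x}. pointwise_tot_var g)"

end

theory Submission
  imports Defs
begin

text \<open>
  The two constrained solvers differ only when the constraint acts, and then only for \<open>x \<ge> 0\<close>.
  The second solver starts there from a state that already has the right velocity \<open>vr\<close>, so only a
  2-contact emanates from the constraint and the velocity of \<open>RSq2\<close> equals \<open>vr\<close> on the whole
  half-line. The velocity of \<open>RSq1\<close> may vary on \<open>x > 0\<close>, but far to the right it equals \<open>vr\<close>
  too, because waves have finite speed. Hence the velocity of \<open>RSq2\<close> arises almost everywhere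
  from that of \<open>RSq1\<close> by reading every \<open>x \<ge> 0\<close> at one far point \<open>T\<close>: a monotone
  reparametrization, and these do not increase the variation. Working with an arbitrary representative of the a.e. class of the first
  velocity gives the same for the essential variation (\<open>tot_var_le_constant_right\<close>).
\<close>

lemma pointwise_tot_var_comp_mono:
  assumes "mono \<phi>"
  shows "pointwise_tot_var (\<lambda>x. g (\<phi> x)) \<le> pointwise_tot_var g"
  unfolding pointwise_tot_var_def
proof (rule SUP_mono)
  fix m :: "nat \<times> (nat \<Rightarrow> real)"
  assume m: "m \<in> {(n, t). mono t}"
  obtain n t where nt: "m = (n, t)" by (cases m)
  have "mono (\<phi> \<circ> t)"
    using m nt assms by (auto simp: mono_def)
  then show "\<exists>k\<in>{(n :: nat, t :: nat \<Rightarrow> real). mono t}.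
      (case m of (n, t) \<Rightarrow> ereal (\<Sum>i<n. \<bar>g (\<phi> (t (Suc i))) - g (\<phi> (t i))\<bar>))
      \<le> (case k of (n, t) \<Rightarrow> ereal (\<Sum>i<n. \<bar>g (t (Suc i)) - g (t i)\<bar>))"
    by (intro bexI[of _ "(n, \<phi> \<circ> t)"]) (auto simp: nt)
qed

text \<open>
  This yields a far point at which a given representative of an a.e. class takes the value
  that the class prescribes: a half-line is not a null set.
\<close>

lemma AE_lebesgue_imp_exists_greater:
  fixes M :: real
  assumes "AE x in lebesgue. P x"
  shows "\<exists>x>M. P x"
proof (rule ccontr)
  assume "\<not> ?thesis"
  then have "{M<..} \<subseteq> {x. \<not> P x}" by auto
  moreover obtain N where "{x. \<not> P x} \<subseteq> N" "N \<in> null_sets lebesgue"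
    using assms by (auto simp: eventually_ae_filter)
  ultimately have "negligible {M<..}"
    using negligible_iff_null_sets negligible_subset by blast
  then show False
    using open_not_negligible[of "{M<..}"] by auto
qed

text \<open>
  Every representative \<open>g\<close> of \<open>f\<close> takes the value \<open>c\<close> at some far point \<open>T\<close>. Collapsing \<open>[0,\<infinity>)\<close> to
  \<open>T\<close> turns \<open>g\<close> into a representative of \<open>h\<close> whose variation is at most that of \<open>g\<close>.
\<close>

lemma tot_var_le_constant_right:
  fixes f h :: "real \<Rightarrow> real"
  assumes left: "\<And>x. x < 0 \<Longrightarrow> h x = f x"
    and right: "\<And>x. x > 0 \<Longrightarrow> h x = c"
    and far: "eventually (\<lambda>x. f x = c) at_top"
  shows "tot_var h \<le> tot_var f"
  unfolding tot_var_def[of f]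
proof (rule INF_greatest)
  fix g assume "g \<in> {g. AE x in lebesgue. g x = f x}"
  then have g: "AE x in lebesgue. g x = f x" by simp
  obtain M where M: "\<And>x. x \<ge> M \<Longrightarrow> f x = c"
    using far by (auto simp: eventually_at_top_linorder)
  obtain T where T: "T > max 0 M" "g T = f T"
    using AE_lebesgue_imp_exists_greater[OF g] by blast
  then have gT: "g T = c" using M by simp
  define \<phi> where "\<phi> x = (if x < 0 then x else T)" for x :: real
  have "mono \<phi>"
    using T(1) by (auto simp: mono_def \<phi>_def)
  \<comment> \<open>Nothing is assumed about \<open>h 0\<close>, where \<open>g (\<phi> 0) = c\<close>.\<close>
  have "AE x in lebesgue. x \<noteq> (0::real)"
    by (rule AE_I'[of "{0}"]) auto
  with g have "AE x in lebesgue. g (\<phi> x) = h x"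
    by eventually_elim (auto simp: \<phi>_def gT left right)
  then have "tot_var h \<le> pointwise_tot_var (\<lambda>x. g (\<phi> x))"
    unfolding tot_var_def by (intro INF_lower) simp
  also have "\<dots> \<le> pointwise_tot_var g"
    by (rule pointwise_tot_var_comp_mono) fact
  finally show "tot_var h \<le> pointwise_tot_var g" .
qed

text \<open>Waves have finite speed, so the right datum is undisturbed far away.\<close>

lemma eventually_RS_eq_right: "eventually (\<lambda>x. RS p l r x = r) at_top"
proof -
  let ?m = "mid_state p l r"
  let ?\<sigma> = "(fst ?m * snd ?m - fst l * snd l) / (fst ?m - fst l)"
  have "eventually (\<lambda>x. x > ?\<sigma> \<and> x > snd r \<and> x > lambda1 p l \<and> x > lambda1 p ?m \<and> x > wvar p l)
          at_top"
    by (intro eventually_conj eventually_gt_at_top)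
  then show ?thesis
    by eventually_elim (auto simp: RS_def Let_def)
qed

text \<open>
  Equal velocities select the first case of the solver, where the intermediate state has the
  velocity of \<open>r\<close> too, so that the solution can jump only in density.
\<close>

lemma snd_RS_of_snd_eq:
  assumes "snd l = snd r"
  shows "snd (RS p l r x) = snd r"
  using assms by (auto simp: RS_def Let_def mid_state_def)

theorem proposition4p2:
  fixes p :: "real \<Rightarrow> real" and q \<rho>l vl \<rho>r vr :: real
  assumes "pressure p"
    and "q > 0"
    and "(\<rho>l, vl) \<in> states"
    and "(\<rho>r, vr) \<in> states"
  shows "tot_var (\<lambda>x. snd (RSq1 p q (\<rho>l, vl) (\<rho>r, vr) x))
           \<ge> tot_var (\<lambda>x. snd (RSq2 p q (\<rho>l, vl) (\<rho>r, vr) x))"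
proof (cases "f1_trace0 (RS p (\<rho>l, vl) (\<rho>r, vr)) \<le> q")
  case True
  then show ?thesis
    by (simp add: RSq1_def RSq2_def constrained_RS_def)
next
  case False
  let ?r = "(\<rho>r, vr)"
  have "eventually (\<lambda>x. RS p (check_state1 p q (\<rho>l, vl)) ?r x = ?r) at_top"
    by (rule eventually_RS_eq_right)
  with eventually_ge_at_top[of "0::real"]
  have far: "eventually (\<lambda>x. snd (RSq1 p q (\<rho>l, vl) ?r x) = vr) at_top"
    by eventually_elim (use False in \<open>simp add: RSq1_def constrained_RS_def\<close>)
  have "snd (RS p (check_state2 q ?r) ?r x) = vr" for x
    by (simp add: snd_RS_of_snd_eq check_state2_def)
  with False have "snd (RSq2 p q (\<rho>l, vl) ?r x) = vr" if "x > 0" for x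
    using that by (simp add: RSq2_def constrained_RS_def)
  with False show ?thesis
    by (intro tot_var_le_constant_right[OF _ _ far])
      (simp_all add: RSq1_def RSq2_def constrained_RS_def)
qed

end
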